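(* Let $X\in\mathsf{PreOrd}_n$. Then the cost of \textsc{Greedy} on $X$ run without initial tree satisfies $\textsc{Greedy}(X)\le 4n$.
   Context: $\mathsf{PreOrd}_n$: a permutation sequence $X=(x_1,\dots,x_n)$ belongs to $\mathsf{PreOrd}_n$ if $n=1$, or there is $n'<n$ such that $(x_2,\dots,x_{n'})\in\mathsf{PreOrd}_{n'-1}$ and $(x_{n'+1},\dots,x_n)\in\mathsf{PreOrd}_{n-n'}$ (each up to order-isomorphism, as sequences of distinct keys), and every element of $(x_2,\dots,x_{n'})$ is smaller than $x_1$, which is smaller than every element of $(x_{n'+1},\dots,x_n)$. (These are the preorder sequences of BSTs.) Geometric model: $X$ gives access points $(x_t,t)$. \textsc{Greedy} without initial tree: let $\tau(b,t)$ be the latest time $\le t$ with an output point in column $b$; at time $t$ with access $(a,t)$, add $(a,t)$ and $(b,t)$ for every $b\ne a$ with $\tau(b,t-1)$ defined such that the closed rectangle with corners $(a,t),(b,\tau(b,t-1))$ contains no output point at times $<t$ other than $(b,\tau(b,t-1))$. $\textsc{Greedy}(X)$ denotes the number of output points. *)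

theory Defs
  imports "HOL-Combinatorics.Multiset_Permutations"
begin

text \<open>
  The node rule with \<open>L = (x\<^sub>2, \<dots>, x\<^sub>n\<^sub>')\<close> and
  \<open>R = (x\<^sub>n\<^sub>'\<^sub>+\<^sub>1, \<dots>, x\<^sub>n)\<close>. Either block may be empty (a missing left or right
  subtree); the one-element sequence is the node rule with both blocks empty.
  Only comparisons between keys are used, so no renaming of the keys of a block is needed.
\<close>

inductive preorder_seq :: "nat list \<Rightarrow> bool" where
  empty: "preorder_seq []"
| node: "\<lbrakk>preorder_seq L; preorder_seq R; \<forall>y\<in>set L. y < x; \<forall>z\<in>set R. x < z\<rbrakk>
         \<Longrightarrow> preorder_seq (x # L @ R)"

definition PreOrd :: "nat \<Rightarrow> nat list set" where
  "PreOrd n = {X \<in> permutations_of_set {1..n}. preorder_seq X}"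

text \<open>Points are pairs (column, time); columns are keys, and times start at 1.\<close>

type_synonym point = "nat \<times> nat"

definition tau :: "point set \<Rightarrow> nat \<Rightarrow> nat \<Rightarrow> nat option" where
  "tau P b t = (if \<exists>s\<le>t. (b, s) \<in> P then Some (Max {s. s \<le> t \<and> (b, s) \<in> P}) else None)"

definition rect :: "point \<Rightarrow> point \<Rightarrow> point set" where
  "rect p q = {min (fst p) (fst q)..max (fst p) (fst q)} \<times> {min (snd p) (snd q)..max (snd p) (snd q)}"

text \<open>The output points at time \<open>t\<close>, where \<open>P\<close> is the set of output points at times \<open>< t\<close>.\<close>

definition greedy_row :: "point set \<Rightarrow> nat \<Rightarrow> nat \<Rightarrow> point set" where
  "greedy_row P a t = insert (a, t)
     {(b, t) | b. b \<noteq> a \<and> (\<exists>s. tau P b (t - 1) = Some s \<and> rect (a, t) (b, s) \<inter> P \<subseteq> {(b, s)})}"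

text \<open>\<open>greedy X t\<close> is the set of output points at times \<open>\<le> t\<close>; the access at time \<open>Suc t\<close> is
  \<open>X ! t\<close> because list indices start at 0.\<close>

primrec greedy :: "nat list \<Rightarrow> nat \<Rightarrow> point set" where
  "greedy X 0 = {}"
| "greedy X (Suc t) = greedy X t \<union> greedy_row (greedy X t) (X ! t) (Suc t)"

definition greedy_cost :: "nat list \<Rightarrow> nat" where
  "greedy_cost X = card (greedy X (length X))"

text \<open>The output is finite, so \<open>card\<close> is a genuine count.\<close>

lemma finite_greedy: "finite (greedy X t)"
proof (induction t)
  case 0
  show ?case by simp
next
  case (Suc t)
  have "greedy_row (greedy X t) (X ! t) (Suc t)
      \<subseteq> insert (X ! t, Suc t) ((\<lambda>p. (fst p, Suc t)) ` greedy X t)"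
    by (force simp: greedy_row_def tau_def split: if_splits)
  with Suc show ?case
    by (auto intro: finite_subset)
qed

end

theory Submission
  imports Defs
begin

text \<open>
  A preorder sequence contains no \<open>231\<close> pattern. Consequently three of the four kinds of
  output points at an access \<open>a\<close> occur at most once per step, the access itself being one of them.
  Right of \<open>a\<close> only the nearest accessed key is touched, since from the current access rightwards
  the latest touch times are weakly decreasing. If the previous access \<open>a'\<close> was larger than \<open>a\<close>, no
  accessed key lies between \<open>a\<close> and \<open>a'\<close>, so the nearest accessed key left of \<open>a\<close> was touched when
  \<open>a'\<close> was accessed and shields everything further left. If \<open>a' < a\<close>, then \<open>a'\<close> itself shields
  everything left of it, so each key \<open>b\<close> touched on the left satisfies \<open>a' \<le> b < a\<close>; no key
  smaller than \<open>b\<close> can follow without producing the pattern \<open>b, a, _\<close>, so \<open>b\<close> is charged in this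
  way only once in the whole run.
\<close>

section \<open>Pattern 231 and preorder sequences\<close>

definition avoids_231 :: "'a::linorder list \<Rightarrow> bool" where
  "avoids_231 X \<longleftrightarrow>
     (\<forall>i j k. i < j \<longrightarrow> j < k \<longrightarrow> k < length X \<longrightarrow> \<not> (X ! k < X ! i \<and> X ! i < X ! j))"

lemma avoids_231D:
  "\<lbrakk>avoids_231 X; i < j; j < k; k < length X; X ! i < X ! j\<rbrakk> \<Longrightarrow> X ! i \<le> X ! k"
  unfolding avoids_231_def by (meson not_less)

text \<open>The last entry of a 231 pattern is its smallest, so an occurrence cannot start in
  \<open>L\<close> and end in \<open>R\<close>; it lies inside one block.\<close>

lemma avoids_231_append:
  assumes "avoids_231 L" "avoids_231 R" and less: "\<forall>y\<in>set L. \<forall>z\<in>set R. y < z"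
  shows "avoids_231 (L @ R)"
  unfolding avoids_231_def
proof (intro allI impI)
  fix i j k
  assume ijk: "i < j" "j < k" "k < length (L @ R)"
  show "\<not> ((L @ R) ! k < (L @ R) ! i \<and> (L @ R) ! i < (L @ R) ! j)"
  proof (cases "k < length L")
    case True
    with ijk assms(1) show ?thesis by (auto simp: nth_append avoids_231_def)
  next
    case k: False
    show ?thesis
    proof (cases "i < length L")
      case True
      with k ijk have "(L @ R) ! i \<in> set L" "(L @ R) ! k \<in> set R"
        by (auto simp: nth_append)
      with less show ?thesis by (meson not_less_iff_gr_or_eq)
    next
      case False
      with k ijk show ?thesis
        using avoids_231D[OF assms(2), of "i - length L" "j - length L" "k - length L"]
        by (auto simp: nth_append not_less)
    qed
  qed
qed

lemma avoids_231_Cons: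
  assumes "avoids_231 xs"
    and "\<And>j k. \<lbrakk>j < k; k < length xs; x < xs ! j\<rbrakk> \<Longrightarrow> x \<le> xs ! k"
  shows "avoids_231 (x # xs)"
  unfolding avoids_231_def
proof (intro allI impI)
  fix i j k
  assume ijk: "i < j" "j < k" "k < length (x # xs)"
  then obtain j' k' where [simp]: "j = Suc j'" "k = Suc k'"
    by (metis less_nat_zero_code not0_implies_Suc)
  show "\<not> ((x # xs) ! k < (x # xs) ! i \<and> (x # xs) ! i < (x # xs) ! j)"
  proof (cases i)
    case 0
    with ijk assms(2)[of j' k'] show ?thesis by auto
  next
    case (Suc i')
    with ijk avoids_231D[OF assms(1), of i' j' k'] show ?thesis by auto
  qed
qed

text \<open>The root \<open>x\<close> never plays the 2: a later entry above it lies in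
  \<open>R\<close>, and so does everything after that entry, which is then also above
  \<open>x\<close>.\<close>

lemma preorder_seq_avoids_231: "preorder_seq X \<Longrightarrow> avoids_231 X"
proof (induction rule: preorder_seq.induct)
  case empty
  show ?case by (simp add: avoids_231_def)
next
  case (node L R x)
  show ?case
  proof (rule avoids_231_Cons)
    show "avoids_231 (L @ R)"
      using node by (intro avoids_231_append) (auto intro: less_trans)
    fix j k
    assume jk: "j < k" "k < length (L @ R)" "x < (L @ R) ! j"
    with node have "\<not> j < length L"
      by (metis nth_append nth_mem not_less_iff_gr_or_eq)
    with jk have "(L @ R) ! k \<in> set R" by (auto simp: nth_append)
    with node show "x \<le> (L @ R) ! k" by (meson less_imp_le)
  qed
qed

section \<open>Empty rectangles in the output of Greedy\<close>

declare greedy.simps(2) [simp del]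

lemma greedy_time: "(b, s) \<in> greedy X t \<Longrightarrow> 0 < s \<and> s \<le> t"
  by (induction t) (auto simp: greedy_row_def greedy.simps(2))

lemma access_in_greedy: "i < t \<Longrightarrow> (X ! i, Suc i) \<in> greedy X t"
  by (induction t) (auto simp: greedy_row_def greedy.simps(2) less_Suc_eq)

lemma greedy_column:
  assumes "t \<le> length X" "(b, s) \<in> greedy X t"
  shows "b \<in> set (take t X)"
  using assms
proof (induction t arbitrary: s)
  case (Suc t)
  then show ?case
    by (fastforce simp: greedy.simps(2) greedy_row_def tau_def take_Suc_conv_app_nth split: if_splits)
qed simp

lemma accessed_column:
  assumes "b \<in> set (take t X)"
  obtains s where "(b, s) \<in> greedy X t"
  using assms access_in_greedy that
  by (metis in_set_conv_nth length_take min_less_iff_conj nth_take)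

text \<open>Every point of \<open>greedy X t\<close> lies below row \<open>Suc t\<close>, so the
  only time condition left from the closed rectangle is \<open>s \<le> u\<close>.\<close>

lemma greedy_row_touchE:
  assumes "(b, Suc t) \<in> greedy_row (greedy X t) a (Suc t)" "b \<noteq> a"
  obtains s where "(b, s) \<in> greedy X t" "s \<le> t"
    and "\<And>c u. \<lbrakk>(c, u) \<in> greedy X t; min a b \<le> c; c \<le> max a b; s \<le> u\<rbrakk> \<Longrightarrow> c = b"
proof -
  let ?P = "greedy X t"
  from assms obtain s where s: "tau ?P b t = Some s" "rect (a, Suc t) (b, s) \<inter> ?P \<subseteq> {(b, s)}"
    by (auto simp: greedy_row_def)
  then have ex: "\<exists>s\<le>t. (b, s) \<in> ?P" and Max: "s = Max {s. s \<le> t \<and> (b, s) \<in> ?P}"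
    by (auto simp: tau_def split: if_splits)
  from ex have "s \<in> {s. s \<le> t \<and> (b, s) \<in> ?P}"
    unfolding Max by (intro Max_in) auto
  then have st: "(b, s) \<in> ?P" "s \<le> t" by auto
  have "c = b" if "(c, u) \<in> ?P" "min a b \<le> c" "c \<le> max a b" "s \<le> u" for c u
  proof -
    from that st greedy_time[OF that(1)] have "(c, u) \<in> rect (a, Suc t) (b, s) \<inter> ?P"
      by (auto simp: rect_def)
    with s show ?thesis by auto
  qed
  with st show thesis by (rule that)
qed

text \<open>The rectangle down to the latest point of \<open>b\<close> meets no output outside
  column \<open>b\<close>. As it is closed, the last assumption also forces column \<open>a\<close>
  to be untouched so far.\<close>

lemma greedy_row_touches_nearest:
  assumes "(b, s) \<in> greedy X t" "b \<noteq> a"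
    and "\<And>c u. \<lbrakk>(c, u) \<in> greedy X t; min a b \<le> c; c \<le> max a b\<rbrakk> \<Longrightarrow> c = b"
  shows "(b, Suc t) \<in> greedy_row (greedy X t) a (Suc t)"
proof -
  let ?P = "greedy X t"
  define m where "m = Max {s. s \<le> t \<and> (b, s) \<in> ?P}"
  have fin: "finite {s. s \<le> t \<and> (b, s) \<in> ?P}" by simp
  have time: "u \<le> t" if "(c, u) \<in> ?P" for c u using greedy_time[OF that] by simp
  have tau: "tau ?P b t = Some m" using assms(1) time by (auto simp: tau_def m_def)
  have "m \<in> {s. s \<le> t \<and> (b, s) \<in> ?P}"
    unfolding m_def using assms(1) time by (intro Max_in fin) auto
  moreover have "u \<le> m" if "(b, u) \<in> ?P" for u
    unfolding m_def using that time by (intro Max_ge fin) auto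
  ultimately have "rect (a, Suc t) (b, m) \<inter> ?P \<subseteq> {(b, m)}"
    using assms(3) by (fastforce simp: rect_def)
  with tau assms(2) show ?thesis by (auto simp: greedy_row_def)
qed

section \<open>Columns touched right and left of an access\<close>

lemma set_take_Suc: "t < length X \<Longrightarrow> set (take (Suc t) X) = insert (X ! t) (set (take t X))"
  by (simp add: take_Suc_conv_app_nth)

text \<open>A violating \<open>y\<close> would be the 2 of a pattern with \<open>X ! t\<close> as 3
  and \<open>X ! Suc t\<close> as 1. At an ascent the claim is mere transitivity, so it serves both
  kinds of step.\<close>

lemma no_accessed_between_descent:
  assumes "avoids_231 X" "Suc t < length X" "y \<in> set (take (Suc t) X)"
    and "X ! Suc t < y"
  shows "X ! t \<le> y"
proof (rule ccontr)
  assume "\<not> X ! t \<le> y"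
  moreover obtain i where "i < Suc t" "y = X ! i"
    using assms(2,3) by (auto simp: in_set_conv_nth)
  ultimately have "i < t" "X ! i < X ! t" by (auto simp: less_Suc_eq)
  with avoids_231D[OF assms(1), of i t "Suc t"] assms \<open>y = X ! i\<close> show False by simp
qed

text \<open>The existential compares latest touch times without maxima. Induction on time: the new
  access has the newest point, and a new point at \<open>z\<close> beyond an old \<open>y\<close> is
  blocked by a point of \<open>y\<close> that the induction hypothesis supplies.\<close>

lemma greedy_times_decrease_right:
  assumes "avoids_231 X" "t < length X" "y \<in> set (take (Suc t) X)"
    and "X ! t \<le> y" "y < z" "(z, s) \<in> greedy X (Suc t)"
  shows "\<exists>u\<ge>s. (y, u) \<in> greedy X (Suc t)"
  using assms(2-)
proof (induction t arbitrary: y z s)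
  case 0
  then show ?case by (auto simp: greedy.simps(2) greedy_row_def tau_def set_take_Suc)
next
  case (Suc t)
  let ?P = "greedy X (Suc t)" and ?a = "X ! Suc t"
  show ?case
  proof (cases "y = ?a")
    case True
    then show ?thesis
      using greedy_time[OF Suc.prems(5)] access_in_greedy[of "Suc t" "Suc (Suc t)" X] by blast
  next
    case False
    with Suc.prems have y: "y \<in> set (take (Suc t) X)" "?a < y" by (auto simp: set_take_Suc)
    \<comment> \<open>The induction hypothesis concerns keys at or right of the previous access;
      231-avoidance puts \<open>y\<close> there.\<close>
    then have "X ! t \<le> y"
      using no_accessed_between_descent[OF assms(1)] Suc.prems by blast
    with Suc y have IH: "\<exists>u\<ge>s. (y, u) \<in> ?P" if "(z, s) \<in> ?P" for s
      using that by auto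
    show ?thesis
    proof (cases "(z, s) \<in> ?P")
      case True
      with IH show ?thesis by (auto simp: greedy.simps(2)[of X "Suc t"])
    next
      case False
      with Suc.prems have row: "(z, Suc (Suc t)) \<in> greedy_row ?P ?a (Suc (Suc t))"
        by (auto simp: greedy.simps(2)[of X "Suc t"] greedy_row_def)
      have "z \<noteq> ?a" using y Suc.prems by auto
      then obtain s' where s': "(z, s') \<in> ?P" "s' \<le> Suc t"
        "\<And>c u. \<lbrakk>(c, u) \<in> ?P; min ?a z \<le> c; c \<le> max ?a z; s' \<le> u\<rbrakk> \<Longrightarrow> c = z"
        by (rule greedy_row_touchE[OF row]) blast
      with IH obtain u where "u \<ge> s'" "(y, u) \<in> ?P" by blast
      with s'(3)[of y u] y Suc.prems show ?thesis by auto
    qed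
  qed
qed

text \<open>A key \<open>y\<close> strictly between the access and \<open>b\<close> has a point at
  least as late as any point of \<open>b\<close>, and that point spoils the rectangle.\<close>

lemma right_touch_nearest:
  assumes "avoids_231 X" "Suc t < length X"
    and row: "(b, Suc (Suc t)) \<in> greedy_row (greedy X (Suc t)) (X ! Suc t) (Suc (Suc t))"
    and "X ! Suc t < b" "y \<in> set (take (Suc t) X)" "X ! Suc t < y"
  shows "b \<le> y"
proof (rule ccontr)
  assume "\<not> b \<le> y"
  have "b \<noteq> X ! Suc t" using assms by auto
  then obtain s where s: "(b, s) \<in> greedy X (Suc t)" "s \<le> Suc t"
    "\<And>c u. \<lbrakk>(c, u) \<in> greedy X (Suc t); min (X ! Suc t) b \<le> c; c \<le> max (X ! Suc t) b; s \<le> u\<rbrakk>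
      \<Longrightarrow> c = b"
    by (rule greedy_row_touchE[OF row]) blast
  have "X ! t \<le> y" using no_accessed_between_descent assms by blast
  then obtain u where "u \<ge> s" "(y, u) \<in> greedy X (Suc t)"
    using greedy_times_decrease_right[OF assms(1), of t y b s] assms \<open>\<not> b \<le> y\<close> s(1) by auto
  with s(3)[of y u] assms \<open>\<not> b \<le> y\<close> show False by auto
qed

lemma left_touch_nearest_descent:
  assumes "avoids_231 X" "distinct X" "Suc t < length X" "X ! Suc t < X ! t"
    and row: "(b, Suc (Suc t)) \<in> greedy_row (greedy X (Suc t)) (X ! Suc t) (Suc (Suc t))"
    and "b < X ! Suc t" "y \<in> set (take (Suc t) X)" "y < X ! Suc t"
  shows "y \<le> b"
proof (rule ccontr)
  assume "\<not> y \<le> b"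
  let ?S = "{y \<in> set (take (Suc t) X). y < X ! Suc t}"
  \<comment> \<open>\<open>m\<close> is the accessed key nearest on the left; it will turn out to be
    touched by the previous access and then to block \<open>b\<close>.\<close>
  define m where "m = Max ?S"
  have "m \<in> ?S" unfolding m_def using assms by (intro Max_in) auto
  then have m: "m \<in> set (take t X)" "m < X ! Suc t"
    using assms by (auto simp: set_take_Suc)
  have max: "c \<le> m" if "c \<in> ?S" for c
    unfolding m_def using that by (intro Max_ge) auto
  obtain s where "(m, s) \<in> greedy X t" using accessed_column m(1) by blast
  then have "(m, Suc t) \<in> greedy_row (greedy X t) (X ! t) (Suc t)"
  proof (rule greedy_row_touches_nearest)
    show "m \<noteq> X ! t" using m assms by auto
    \<comment> \<open>Between \<open>m\<close> and \<open>X ! t\<close>, keys above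
      \<open>X ! Suc t\<close> are excluded by 231-avoidance, keys below it by maximality of
      \<open>m\<close>, and the two accesses themselves by distinctness.\<close>
    fix c u
    assume c: "(c, u) \<in> greedy X t" "min (X ! t) m \<le> c" "c \<le> max (X ! t) m"
    have *: "c \<in> set (take t X)" using greedy_column[OF _ c(1)] assms by simp
    have new: "X ! i \<notin> set (take t X)" if "t \<le> i" "i < length X" for i
      using that assms(2) by (auto simp: in_set_conv_nth nth_eq_iff_index_eq)
    have "c \<noteq> X ! t" "c \<noteq> X ! Suc t"
      using * new[of t] new[of "Suc t"] assms by auto
    with c m assms have "c < X ! t" by auto
    then have "\<not> X ! Suc t < c"
      using no_accessed_between_descent[OF assms(1,3), of c] * assms(3)
      by (auto simp: set_take_Suc)
    with \<open>c \<noteq> X ! Suc t\<close> have "c < X ! Suc t" by simp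
    then show "c = m" using max[of c] * c m assms by (auto simp: set_take_Suc)
  qed
  then have mt: "(m, Suc t) \<in> greedy X (Suc t)" by (simp add: greedy.simps(2))
  have "b \<noteq> X ! Suc t" using assms by auto
  then obtain s where s: "(b, s) \<in> greedy X (Suc t)" "s \<le> Suc t"
    "\<And>c u. \<lbrakk>(c, u) \<in> greedy X (Suc t); min (X ! Suc t) b \<le> c; c \<le> max (X ! Suc t) b; s \<le> u\<rbrakk>
      \<Longrightarrow> c = b"
    by (rule greedy_row_touchE[OF row]) blast
  \<comment> \<open>No point so far is later than \<open>(m, Suc t)\<close>, so it lies in the
    rectangle towards any \<open>b < m\<close>.\<close>
  have "b < m" using max[of y] assms \<open>\<not> y \<le> b\<close> by auto
  with s(3)[OF mt] s(2) m show False by auto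
qed

lemma left_touch_ascent:
  assumes "X ! t < X ! Suc t"
    and row: "(b, Suc (Suc t)) \<in> greedy_row (greedy X (Suc t)) (X ! Suc t) (Suc (Suc t))"
    and "b < X ! Suc t"
  shows "X ! t \<le> b"
proof (rule ccontr)
  assume "\<not> X ! t \<le> b"
  have "b \<noteq> X ! Suc t" using assms by auto
  then obtain s where s: "(b, s) \<in> greedy X (Suc t)" "s \<le> Suc t"
    "\<And>c u. \<lbrakk>(c, u) \<in> greedy X (Suc t); min (X ! Suc t) b \<le> c; c \<le> max (X ! Suc t) b; s \<le> u\<rbrakk>
      \<Longrightarrow> c = b"
    by (rule greedy_row_touchE[OF row]) blast
  have "(X ! t, Suc t) \<in> greedy X (Suc t)" by (rule access_in_greedy) simp
  from s(3)[OF this] s(2) assms \<open>\<not> X ! t \<le> b\<close> show False by auto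
qed

section \<open>Charging left touches at ascents\<close>

text \<open>A superset, read off \<open>X\<close> alone, of the keys touched on the left at an
  ascent. At a descent it is empty, so all steps may be summed.\<close>

definition ascent_keys :: "'a::linorder list \<Rightarrow> nat \<Rightarrow> 'a set" where
  "ascent_keys X t = {b \<in> set (take (Suc t) X). X ! t \<le> b \<and> b < X ! Suc t}"

text \<open>A common \<open>b\<close> gives the pattern \<open>b\<close>, \<open>X ! Suc t\<close>,
  \<open>X ! u\<close>. Here \<open>u\<close> differs from \<open>Suc t\<close> because
  \<open>X ! u \<le> b < X ! Suc t\<close>, and distinctness makes the first inequality
  strict.\<close>

lemma ascent_keys_disjoint:
  assumes "avoids_231 X" "distinct X" "Suc u < length X" "t < u"
  shows "ascent_keys X t \<inter> ascent_keys X u = {}"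
proof (rule ccontr)
  assume "ascent_keys X t \<inter> ascent_keys X u \<noteq> {}"
  then obtain b where b: "b \<in> set (take (Suc t) X)" "b < X ! Suc t" "X ! u \<le> b"
    by (auto simp: ascent_keys_def)
  then obtain i where i: "i < Suc t" "b = X ! i" by (auto simp: in_set_conv_nth)
  have "X ! u \<noteq> b" using i assms by (auto simp: nth_eq_iff_index_eq)
  moreover have "u \<noteq> Suc t" using b by auto
  ultimately show False
    using avoids_231D[OF assms(1), of i "Suc t" u] b i assms by auto
qed

lemma sum_card_ascent_keys_le:
  assumes "avoids_231 X" "distinct X"
  shows "(\<Sum>t<length X - 1. card (ascent_keys X t)) \<le> length X"
proof -
  have "(\<Sum>t<length X - 1. card (ascent_keys X t)) = card (\<Union>t<length X - 1. ascent_keys X t)"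
  proof (rule card_UN_disjoint[symmetric])
    show "\<forall>i\<in>{..<length X - 1}. \<forall>j\<in>{..<length X - 1}. i \<noteq> j \<longrightarrow>
            ascent_keys X i \<inter> ascent_keys X j = {}"
    proof (intro ballI impI)
      fix i j
      assume "i \<in> {..<length X - 1}" "j \<in> {..<length X - 1}" "i \<noteq> j"
      then show "ascent_keys X i \<inter> ascent_keys X j = {}"
        using ascent_keys_disjoint[OF assms, of i j] ascent_keys_disjoint[OF assms, of j i]
        by (cases i j rule: linorder_cases) (simp_all add: less_diff_conv Int_commute)
    qed
  qed (auto simp: ascent_keys_def)
  also have "\<dots> \<le> card (set X)"
    by (intro card_mono) (auto simp: ascent_keys_def dest: in_set_takeD)
  finally show ?thesis using card_length[of X] by simp
qed

text \<open>The 3 pays for the access, at most one right touch, and at most one left touch at a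
  descent; left touches at an ascent are paid by \<open>ascent_keys\<close>.\<close>

lemma card_greedy_row_le:
  assumes "avoids_231 X" "distinct X" "Suc t < length X"
  shows "card (greedy_row (greedy X (Suc t)) (X ! Suc t) (Suc (Suc t)))
    \<le> 3 + card (ascent_keys X t)"
proof -
  let ?a = "X ! Suc t" and ?row = "greedy_row (greedy X (Suc t)) (X ! Suc t) (Suc (Suc t))"
  let ?old = "set (take (Suc t) X)"
  define T where "T = {b. (b, Suc (Suc t)) \<in> ?row}"
  \<comment> \<open>Touched columns other than \<open>?a\<close> were accessed before, so one
    touched key can serve as the \<open>y\<close> against another; this yields uniqueness on the
    right, and on the left at a descent.\<close>
  have old: "b \<in> ?old" if "b \<in> T" "b \<noteq> ?a" for b
  proof -
    from that have "(b, Suc (Suc t)) \<in> greedy X (Suc (Suc t))"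
      by (simp add: T_def greedy.simps(2)[of X "Suc t"])
    from greedy_column[OF _ this] that assms show ?thesis by (simp add: set_take_Suc)
  qed
  have "T \<subseteq> insert ?a ?old" using old by blast
  then have fin: "finite T" by (rule finite_subset) simp
  have "card {b \<in> T. ?a < b} \<le> 1"
  proof (rule card_le_Suc0_iff_eq[THEN iffD2, folded One_nat_def])
    show "\<forall>b\<in>{b \<in> T. ?a < b}. \<forall>c\<in>{b \<in> T. ?a < b}. b = c"
      using right_touch_nearest[OF assms(1,3)] old
      by (auto simp: T_def intro!: antisym)
  qed (use fin in simp)
  moreover have "card {b \<in> T. b < ?a} \<le> 1 + card (ascent_keys X t)"
  proof (cases "?a < X ! t")
    case True
    have "card {b \<in> T. b < ?a} \<le> 1"
    proof (rule card_le_Suc0_iff_eq[THEN iffD2, folded One_nat_def])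
      show "\<forall>b\<in>{b \<in> T. b < ?a}. \<forall>c\<in>{b \<in> T. b < ?a}. b = c"
        using left_touch_nearest_descent[OF assms True] old
        by (auto simp: T_def intro!: antisym)
    qed (use fin in simp)
    then show ?thesis by simp
  next
    case False
    moreover have "?a \<noteq> X ! t" using assms by (simp add: nth_eq_iff_index_eq)
    ultimately have "X ! t < ?a" by simp
    then have "{b \<in> T. b < ?a} \<subseteq> ascent_keys X t"
      using left_touch_ascent[of X t] old by (auto simp: ascent_keys_def T_def)
    then have "card {b \<in> T. b < ?a} \<le> card (ascent_keys X t)"
      by (intro card_mono) (auto simp: ascent_keys_def)
    then show ?thesis by simp
  qed
  moreover have "T \<subseteq> {?a} \<union> ({b \<in> T. ?a < b} \<union> {b \<in> T. b < ?a})" by auto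
  then have "card T \<le> card ({?a} \<union> ({b \<in> T. ?a < b} \<union> {b \<in> T. b < ?a}))"
    using fin by (intro card_mono) auto
  then have "card T \<le> 1 + (card {b \<in> T. ?a < b} + card {b \<in> T. b < ?a})"
    using card_Un_le[of "{?a}" "{b \<in> T. ?a < b} \<union> {b \<in> T. b < ?a}"]
      card_Un_le[of "{b \<in> T. ?a < b}" "{b \<in> T. b < ?a}"] by simp
  moreover have "?row = (\<lambda>b. (b, Suc (Suc t))) ` T" by (auto simp: T_def greedy_row_def)
  then have "card ?row \<le> card T" using fin by (simp add: card_image_le)
  ultimately show ?thesis by linarith
qed

text \<open>Row \<open>Suc (Suc i)\<close> is charged to \<open>ascent_keys X i\<close>; the first
  row is a single access point.\<close>

lemma card_greedy_le:
  assumes "avoids_231 X" "distinct X" "t < length X"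
  shows "card (greedy X (Suc t)) \<le> 3 * Suc t + (\<Sum>i<t. card (ascent_keys X i))"
  using assms(3)
proof (induction t)
  case 0
  have "greedy X (Suc 0) = {(X ! 0, Suc 0)}" by (auto simp: greedy.simps(2) greedy_row_def tau_def)
  then show ?case by simp
next
  case (Suc t)
  have "card (greedy X (Suc (Suc t))) \<le> card (greedy X (Suc t)) +
      card (greedy_row (greedy X (Suc t)) (X ! Suc t) (Suc (Suc t)))"
    by (subst greedy.simps(2)) (rule card_Un_le)
  with card_greedy_row_le[OF assms(1,2) Suc.prems] Suc show ?case
    by simp
qed

theorem mainTheorem16:
  fixes n :: nat and X :: "nat list"
  assumes "X \<in> PreOrd n"
  shows "greedy_cost X \<le> 4 * n"
proof (cases X)
  case Nil
  then show ?thesis by (simp add: greedy_cost_def)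
next
  case (Cons x xs)
  from assms have X: "distinct X" "avoids_231 X" "length X = n"
    using preorder_seq_avoids_231
    by (auto simp: PreOrd_def permutations_of_set_def dest: distinct_card)
  \<comment> \<open>As \<open>X\<close> is nonempty, \<open>length X - 1\<close> is its last index;
    the bound there is \<open>3 * n\<close> plus at most \<open>n\<close> ascent charges.\<close>
  from Cons have "Suc (length X - 1) = length X" "length X - 1 < length X" by auto
  with card_greedy_le[OF X(2,1), of "length X - 1"] sum_card_ascent_keys_le[OF X(2,1)] X(3)
  show ?thesis by (simp add: greedy_cost_def)
qed

end
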